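(* Let $(\mathcal W,[h])$ be a shearfree structure on a manifold $M$ and $(g_o,\mathrm p_o)$ a compatible shearfree pair, hence of the form $$g_o=h_o+2\,\mathrm q_o^*\vee\mathrm p_o^*,$$ where $\mathrm q_o^*$ and $\mathrm p_o^*$ are the 1-forms determined by a triple $(h_o,\mathrm p_o,(\mathcal W'_o,\mathrm q_o))$ consisting of a degenerate metric $h_o\in[h]$, the nowhere vanishing vector field $\mathrm p_o\in\mathcal K_h$ and a rigging $(\mathcal W_o',\mathrm q_o)$, and $h_o$ is regarded as a degenerate metric on $TM$ with $\ker h_o=\langle\mathrm p_o,\mathrm q_o\rangle$. Then any other Lorentzian metric $g$ compatible with $(\mathcal W,[h])$ has locally the form $$g=\sigma h_o+2\,\mathrm q_o^*\vee\varpi=\sigma h_o+2\,\mathrm p_o^\flat\vee\varpi,\qquad \mathrm p_o^\flat=g_o(\mathrm p_o,\cdot)=\mathrm q_o^*,$$ for some positive function $\sigma>0$ and a 1-form $\varpi$ with $\varpi(\mathrm p_o)\neq0$.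
   Context: Conventions: $\alpha\vee\beta=\frac12(\alpha\otimes\beta+\beta\otimes\alpha)$; $\mathrm p^\flat=g(\mathrm p,\cdot)$; Lorentzian metrics have signature $(-,+,\dots,+)$. A shearfree structure on $M$ is a pair $(\mathcal W,[h])$ of a codimension one distribution $\mathcal W\subset TM$ and a conformal class $[h]$ of semipositive degenerate metrics on $\mathcal W$ with one-dimensional kernel $\mathcal K_h=\ker h\subset\mathcal W$, such that one (hence each) nowhere vanishing vector field $\mathrm p$ in $\mathcal K_h$ satisfies $\mathcal L_{\mathrm p}\mathcal W\subset\mathcal W$ and $\mathcal L_{\mathrm p}[h]=[h]$ (i.e. $\mathcal L_{\mathrm p}h=fh$ for some function $f$). A shearfree pair $(g,\mathrm p)$ is a Lorentzian metric $g$ with a (nowhere vanishing) $g$-null vector field $\mathrm p$ such that $\mathcal L_{\mathrm p}X\in\mathrm p^\perp$ for all $X\in\mathrm p^\perp$ and $\mathcal L_{\mathrm p}(g|_{\mathrm p^\perp})=f\,g|_{\mathrm p^\perp}$ for some function $f$. It is compatible with $(\mathcal W,[h])$ if $\ker\mathrm p^\flat=\mathcal W$ and $[g|_{\mathcal W}]=[h]$; in this case $g$ is called a compatible metric. A rigging for $(\mathcal W,[h])$ is a pair $(\mathcal W',\mathrm q)$ of a subdistribution $\mathcal W'\subset\mathcal W$ complementary to $\mathcal K_h$ in $\mathcal W$ and a vector field $\mathrm q$ transversal to $\mathcal W$. Given also a nowhere vanishing $\mathrm p\in\mathcal K_h$, the 1-forms $\mathrm p^*,\mathrm q^*$ are determined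 by $\mathrm p^*(\mathrm p)=1$, $\ker\mathrm p^*=\mathcal W'+\langle\mathrm q\rangle$, and $\mathrm q^*(\mathrm q)=1$, $\ker\mathrm q^*=\mathcal W$. *)

theory Defs
  imports "HOL-Analysis.Analysis" "HOL-Library.Function_Algebras"
begin

section \<open>Smooth manifolds\<close>

text \<open>\<open>C_k k S f\<close> is meant for open \<open>S\<close>: all iterated directional derivatives of \<open>f\<close> up to
  order \<open>k\<close> exist as total derivatives and are continuous on \<open>S\<close>.\<close>

primrec C_k :: "nat \<Rightarrow> 'b::real_normed_vector set \<Rightarrow> ('b \<Rightarrow> 'c::real_normed_vector) \<Rightarrow> bool" where
  "C_k 0 S f \<longleftrightarrow> continuous_on S f"
| "C_k (Suc k) S f \<longleftrightarrow> (\<forall>x\<in>S. f differentiable (at x)) \<and>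
     (\<forall>v. C_k k S (\<lambda>x. frechet_derivative f (at x) v))"

definition C_infinity :: "'b::real_normed_vector set \<Rightarrow> ('b \<Rightarrow> 'c::real_normed_vector) \<Rightarrow> bool" where
  "C_infinity S f \<longleftrightarrow> (\<forall>k. C_k k S f)"

text \<open>A chart is a pair of a domain and a coordinate map; only the values of the coordinate map
  on the domain matter.\<close>

type_synonym ('a, 'b) chart = "'a set \<times> ('a \<Rightarrow> 'b)"

definition is_chart :: "('a::topological_space, 'b::euclidean_space) chart \<Rightarrow> bool" where
  "is_chart c \<longleftrightarrow> (case c of (U, \<phi>) \<Rightarrow>
     open U \<and> open (\<phi> ` U) \<and> homeomorphism U (\<phi> ` U) \<phi> (inv_into U \<phi>))"

text \<open>The manifold has the whole type \<open>'a\<close> as its set of points, and its dimension is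
  \<open>DIM('b)\<close>. The atlas need not be maximal.\<close>

definition smooth_manifold ::
  "('a::{t2_space, second_countable_topology}, 'b::euclidean_space) chart set \<Rightarrow> bool" where
  "smooth_manifold A \<longleftrightarrow>
     (\<forall>c\<in>A. is_chart c) \<and> (\<Union>(U, \<phi>)\<in>A. U) = UNIV \<and>
     (\<forall>(U, \<phi>)\<in>A. \<forall>(V, \<psi>)\<in>A. C_infinity (\<phi> ` (U \<inter> V)) (\<psi> \<circ> inv_into U \<phi>))"

text \<open>Smooth real functions on an open set \<open>S\<close> of the manifold; values off \<open>S\<close> are irrelevant.\<close>

definition smooth_fun ::
  "('a::topological_space, 'b::euclidean_space) chart set \<Rightarrow> 'a set \<Rightarrow> ('a \<Rightarrow> real) \<Rightarrow> bool" where
  "smooth_fun A S f \<longleftrightarrow> (\<forall>(U, \<phi>)\<in>A. C_infinity (\<phi> ` (U \<inter> S)) (f \<circ> inv_into U \<phi>))"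

definition smooth_near ::
  "('a::topological_space, 'b::euclidean_space) chart set \<Rightarrow> 'a \<Rightarrow> ('a \<Rightarrow> real) \<Rightarrow> bool" where
  "smooth_near A x f \<longleftrightarrow> (\<exists>U. open U \<and> x \<in> U \<and> smooth_fun A U f)"


section \<open>Tangent vectors and vector fields\<close>

text \<open>Tangent vectors at \<open>x\<close> are the derivations at \<open>x\<close> of the functions that are smooth near \<open>x\<close>.
  The value on any other function is fixed to be 0, so that equality of tangent vectors is equality
  of functionals. Such a derivation depends only on the germ of its argument: if \<open>f\<close> vanishes near
  \<open>x\<close>, apply the Leibniz rule to the product of \<open>f\<close> with the indicator function of a neighbourhood
  of \<open>x\<close> on which \<open>f\<close> vanishes.\<close>

type_synonym 'a tvec = "('a \<Rightarrow> real) \<Rightarrow> real"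

definition tscale :: "real \<Rightarrow> 'a tvec \<Rightarrow> 'a tvec" where
  "tscale c X = (\<lambda>f. c * X f)"

global_interpretation tvec: vector_space "tscale :: real \<Rightarrow> 'a tvec \<Rightarrow> 'a tvec"
  by unfold_locales (auto simp: tscale_def fun_eq_iff algebra_simps)

definition tangent_space ::
  "('a::topological_space, 'b::euclidean_space) chart set \<Rightarrow> 'a \<Rightarrow> 'a tvec set" where
  "tangent_space A x = {X.
     (\<forall>f. \<not> smooth_near A x f \<longrightarrow> X f = 0) \<and>
     (\<forall>f g. smooth_near A x f \<longrightarrow> smooth_near A x g \<longrightarrow>
        X (\<lambda>y. f y + g y) = X f + X g \<and>
        X (\<lambda>y. f y * g y) = f x * X g + g x * X f) \<and>
     (\<forall>f c. smooth_near A x f \<longrightarrow> X (\<lambda>y. c * f y) = c * X f)}"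

definition vector_field ::
  "('a::topological_space, 'b::euclidean_space) chart set \<Rightarrow> 'a set \<Rightarrow> ('a \<Rightarrow> 'a tvec) \<Rightarrow> bool" where
  "vector_field A U X \<longleftrightarrow> (\<forall>x\<in>U. X x \<in> tangent_space A x) \<and>
     (\<forall>V f. open V \<longrightarrow> V \<subseteq> U \<longrightarrow> smooth_fun A V f \<longrightarrow> smooth_fun A V (\<lambda>x. X x f))"

text \<open>\<open>section_of A U D X\<close>: \<open>X\<close> is a smooth section over \<open>U\<close> of the field \<open>D\<close> of tangent subspaces.\<close>

definition section_of :: "('a::topological_space, 'b::euclidean_space) chart set \<Rightarrow> 'a set \<Rightarrow>
    ('a \<Rightarrow> 'a tvec set) \<Rightarrow> ('a \<Rightarrow> 'a tvec) \<Rightarrow> bool" where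
  "section_of A U D X \<longleftrightarrow> vector_field A U X \<and> (\<forall>x\<in>U. X x \<in> D x)"

definition lie_bracket :: "('a::topological_space, 'b::euclidean_space) chart set \<Rightarrow>
    ('a \<Rightarrow> 'a tvec) \<Rightarrow> ('a \<Rightarrow> 'a tvec) \<Rightarrow> 'a \<Rightarrow> 'a tvec" where
  "lie_bracket A X Y x =
     (\<lambda>f. if smooth_near A x f then X x (\<lambda>y. Y y f) - Y x (\<lambda>y. X y f) else 0)"

definition distribution :: "('a::topological_space, 'b::euclidean_space) chart set \<Rightarrow> nat \<Rightarrow>
    ('a \<Rightarrow> 'a tvec set) \<Rightarrow> bool" where
  "distribution A k D \<longleftrightarrow> (\<forall>x. \<exists>U E. open U \<and> x \<in> U \<and> (\<forall>i<k. vector_field A U (E i)) \<and>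
     (\<forall>y\<in>U. inj_on (\<lambda>i. E i y) {..<k} \<and> tvec.independent ((\<lambda>i. E i y) ` {..<k}) \<and>
            tvec.span ((\<lambda>i. E i y) ` {..<k}) = D y))"

definition codim_one_distribution ::
  "('a::topological_space, 'b::euclidean_space) chart set \<Rightarrow> ('a \<Rightarrow> 'a tvec set) \<Rightarrow> bool" where
  "codim_one_distribution A D \<longleftrightarrow> (\<exists>k. Suc k = DIM('b) \<and> distribution A k D)"


section \<open>Covariant tensor fields\<close>

type_synonym 'a form1 = "'a \<Rightarrow> 'a tvec \<Rightarrow> real"
type_synonym 'a form2 = "'a \<Rightarrow> 'a tvec \<Rightarrow> 'a tvec \<Rightarrow> real"

definition one_form ::
  "('a::topological_space, 'b::euclidean_space) chart set \<Rightarrow> 'a set \<Rightarrow> 'a form1 \<Rightarrow> bool" where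
  "one_form A U \<omega> \<longleftrightarrow>
     (\<forall>x\<in>U. \<forall>X\<in>tangent_space A x. \<forall>Y\<in>tangent_space A x. \<forall>c.
        \<omega> x (X + Y) = \<omega> x X + \<omega> x Y \<and> \<omega> x (tscale c X) = c * \<omega> x X) \<and>
     (\<forall>V X. open V \<longrightarrow> V \<subseteq> U \<longrightarrow> vector_field A V X \<longrightarrow> smooth_fun A V (\<lambda>x. \<omega> x (X x)))"

text \<open>Smooth fields of symmetric bilinear forms on a field \<open>D\<close> of tangent subspaces. Only the values
  on vectors of \<open>D\<close> matter, so a form on the tangent bundle is at the same time its own
  restriction to any distribution.\<close>

definition sym_form :: "('a::topological_space, 'b::euclidean_space) chart set \<Rightarrow>
    ('a \<Rightarrow> 'a tvec set) \<Rightarrow> 'a form2 \<Rightarrow> bool" where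
  "sym_form A D h \<longleftrightarrow>
     (\<forall>x. \<forall>X\<in>D x. \<forall>Y\<in>D x. h x X Y = h x Y X) \<and>
     (\<forall>x. \<forall>X\<in>D x. \<forall>Y\<in>D x. \<forall>Z\<in>D x. \<forall>c.
        h x (X + Y) Z = h x X Z + h x Y Z \<and> h x (tscale c X) Z = c * h x X Z) \<and>
     (\<forall>U X Y. open U \<longrightarrow> section_of A U D X \<longrightarrow> section_of A U D Y \<longrightarrow>
        smooth_fun A U (\<lambda>x. h x (X x) (Y x)))"

definition form_kernel :: "('a \<Rightarrow> 'a tvec set) \<Rightarrow> 'a form2 \<Rightarrow> 'a \<Rightarrow> 'a tvec set" where
  "form_kernel D h x = {X \<in> D x. \<forall>Y\<in>D x. h x X Y = 0}"

definition semipositive_metric :: "('a::topological_space, 'b::euclidean_space) chart set \<Rightarrow>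
    ('a \<Rightarrow> 'a tvec set) \<Rightarrow> 'a form2 \<Rightarrow> bool" where
  "semipositive_metric A D h \<longleftrightarrow> sym_form A D h \<and> (\<forall>x. \<forall>X\<in>D x. 0 \<le> h x X X)"

definition conformal_class :: "('a::topological_space, 'b::euclidean_space) chart set \<Rightarrow>
    ('a \<Rightarrow> 'a tvec set) \<Rightarrow> 'a form2 \<Rightarrow> 'a form2 set" where
  "conformal_class A D h = {h'. \<exists>f. smooth_fun A UNIV f \<and>
     (\<forall>x. 0 < f x \<and> (\<forall>X\<in>D x. \<forall>Y\<in>D x. h' x X Y = f x * h x X Y))}"

definition lorentzian_metric ::
  "('a::topological_space, 'b::euclidean_space) chart set \<Rightarrow> 'a form2 \<Rightarrow> bool" where
  "lorentzian_metric A g \<longleftrightarrow> sym_form A (tangent_space A) g \<and>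
     (\<forall>x. \<exists>B e. tvec.independent B \<and> tvec.span B = tangent_space A x \<and>
        e \<in> B \<and> g x e e = - 1 \<and> (\<forall>b\<in>B - {e}. g x b b = 1) \<and>
        (\<forall>b\<in>B. \<forall>b'\<in>B. b \<noteq> b' \<longrightarrow> g x b b' = 0))"

definition flat :: "'a form2 \<Rightarrow> ('a \<Rightarrow> 'a tvec) \<Rightarrow> 'a form1" where
  "flat g p x X = g x (p x) X"

definition sym_prod :: "'a form1 \<Rightarrow> 'a form1 \<Rightarrow> 'a form2" (infixl "\<or>\<^sub>s" 70) where
  "(\<alpha> \<or>\<^sub>s \<beta>) x X Y = 1/2 * (\<alpha> x X * \<beta> x Y + \<beta> x X * \<alpha> x Y)"

definition perp :: "('a::topological_space, 'b::euclidean_space) chart set \<Rightarrow> 'a form2 \<Rightarrow>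
    ('a \<Rightarrow> 'a tvec) \<Rightarrow> 'a \<Rightarrow> 'a tvec set" where
  "perp A g p x = {X \<in> tangent_space A x. g x (p x) X = 0}"


section \<open>Shearfree structures and shearfree pairs\<close>

text \<open>The conditions below are imposed on local sections. The Lie derivative of \<open>h\<close> along \<open>p\<close> is
  evaluated on \<open>X\<close>, \<open>Y\<close> as \<open>p(h(X,Y)) - h([p,X],Y) - h(X,[p,Y])\<close>; it makes sense for a form \<open>h\<close>
  defined only on \<open>D\<close> when \<open>lie_preserves A p D\<close> holds.\<close>

definition lie_preserves :: "('a::topological_space, 'b::euclidean_space) chart set \<Rightarrow>
    ('a \<Rightarrow> 'a tvec) \<Rightarrow> ('a \<Rightarrow> 'a tvec set) \<Rightarrow> bool" where
  "lie_preserves A p D \<longleftrightarrow>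
     (\<forall>U X. open U \<longrightarrow> section_of A U D X \<longrightarrow> (\<forall>x\<in>U. lie_bracket A p X x \<in> D x))"

definition lie_deriv :: "('a::topological_space, 'b::euclidean_space) chart set \<Rightarrow>
    ('a \<Rightarrow> 'a tvec) \<Rightarrow> 'a form2 \<Rightarrow> ('a \<Rightarrow> 'a tvec) \<Rightarrow> ('a \<Rightarrow> 'a tvec) \<Rightarrow> 'a \<Rightarrow> real" where
  "lie_deriv A p h X Y x = p x (\<lambda>y. h y (X y) (Y y))
     - h x (lie_bracket A p X x) (Y x) - h x (X x) (lie_bracket A p Y x)"

definition lie_conformal :: "('a::topological_space, 'b::euclidean_space) chart set \<Rightarrow>
    ('a \<Rightarrow> 'a tvec) \<Rightarrow> ('a \<Rightarrow> 'a tvec set) \<Rightarrow> 'a form2 \<Rightarrow> bool" where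
  "lie_conformal A p D h \<longleftrightarrow> (\<exists>f. smooth_fun A UNIV f \<and>
     (\<forall>U X Y. open U \<longrightarrow> section_of A U D X \<longrightarrow> section_of A U D Y \<longrightarrow>
        (\<forall>x\<in>U. lie_deriv A p h X Y x = f x * h x (X x) (Y x))))"

definition nonvanishing_section :: "('a::topological_space, 'b::euclidean_space) chart set \<Rightarrow>
    ('a \<Rightarrow> 'a tvec set) \<Rightarrow> ('a \<Rightarrow> 'a tvec) \<Rightarrow> bool" where
  "nonvanishing_section A D p \<longleftrightarrow> section_of A UNIV D p \<and> (\<forall>x. p x \<noteq> 0)"

text \<open>The second component \<open>C\<close> is the conformal class, as a set of metrics on \<open>W\<close>.\<close>

definition shearfree_structure :: "('a::topological_space, 'b::euclidean_space) chart set \<Rightarrow>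
    ('a \<Rightarrow> 'a tvec set) \<Rightarrow> 'a form2 set \<Rightarrow> bool" where
  "shearfree_structure A W C \<longleftrightarrow> codim_one_distribution A W \<and>
     (\<exists>h. semipositive_metric A W h \<and> C = conformal_class A W h \<and>
        (\<forall>x. tvec.dim (form_kernel W h x) = 1) \<and>
        (\<exists>p. nonvanishing_section A (form_kernel W h) p \<and>
           lie_preserves A p W \<and> lie_conformal A p W h))"

definition shearfree_pair :: "('a::topological_space, 'b::euclidean_space) chart set \<Rightarrow>
    'a form2 \<Rightarrow> ('a \<Rightarrow> 'a tvec) \<Rightarrow> bool" where
  "shearfree_pair A g p \<longleftrightarrow> lorentzian_metric A g \<and>
     nonvanishing_section A (tangent_space A) p \<and> (\<forall>x. g x (p x) (p x) = 0) \<and>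
     lie_preserves A p (perp A g p) \<and> lie_conformal A p (perp A g p) g"

definition compatible_pair :: "('a::topological_space, 'b::euclidean_space) chart set \<Rightarrow>
    ('a \<Rightarrow> 'a tvec set) \<Rightarrow> 'a form2 set \<Rightarrow> 'a form2 \<Rightarrow> ('a \<Rightarrow> 'a tvec) \<Rightarrow> bool" where
  "compatible_pair A W C g p \<longleftrightarrow> shearfree_pair A g p \<and>
     (\<forall>x. {X \<in> tangent_space A x. flat g p x X = 0} = W x) \<and> conformal_class A W g = C"

definition compatible_metric :: "('a::topological_space, 'b::euclidean_space) chart set \<Rightarrow>
    ('a \<Rightarrow> 'a tvec set) \<Rightarrow> 'a form2 set \<Rightarrow> 'a form2 \<Rightarrow> bool" where
  "compatible_metric A W C g \<longleftrightarrow> (\<exists>p. compatible_pair A W C g p)"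

text \<open>\<open>K\<close> is the kernel of the conformal class.\<close>

definition rigging :: "('a::topological_space, 'b::euclidean_space) chart set \<Rightarrow>
    ('a \<Rightarrow> 'a tvec set) \<Rightarrow> ('a \<Rightarrow> 'a tvec set) \<Rightarrow> ('a \<Rightarrow> 'a tvec set) \<Rightarrow> ('a \<Rightarrow> 'a tvec) \<Rightarrow> bool" where
  "rigging A W K W' q \<longleftrightarrow> (\<exists>k. distribution A k W') \<and>
     (\<forall>x. W' x \<subseteq> W x \<and> W' x \<inter> K x = {0} \<and> tvec.span (W' x \<union> K x) = W x) \<and>
     vector_field A UNIV q \<and> (\<forall>x. q x \<notin> W x)"

text \<open>\<open>ps\<close> and \<open>qs\<close> are the forms \<open>p\<^sup>*\<close> and \<open>q\<^sup>*\<close>.\<close>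

definition dual_forms :: "('a::topological_space, 'b::euclidean_space) chart set \<Rightarrow>
    ('a \<Rightarrow> 'a tvec set) \<Rightarrow> ('a \<Rightarrow> 'a tvec) \<Rightarrow> ('a \<Rightarrow> 'a tvec set) \<Rightarrow> ('a \<Rightarrow> 'a tvec) \<Rightarrow>
    'a form1 \<Rightarrow> 'a form1 \<Rightarrow> bool" where
  "dual_forms A W p W' q ps qs \<longleftrightarrow> one_form A UNIV ps \<and> one_form A UNIV qs \<and>
     (\<forall>x. ps x (p x) = 1 \<and>
          {X \<in> tangent_space A x. ps x X = 0} = tvec.span (W' x \<union> {q x})) \<and>
     (\<forall>x. qs x (q x) = 1 \<and> {X \<in> tangent_space A x. qs x X = 0} = W x)"

end

theory Submission
  imports Defs
begin

text \<open>Both \<open>go\<close> and \<open>g\<close> restrict to representatives of the conformal class on \<open>W\<close>, and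
  \<open>go = ho\<close> there because \<open>q\<^sup>*\<close> vanishes on \<open>W\<close>. Hence \<open>g = \<sigma> ho\<close> on \<open>W\<close> for a smooth
  positive \<open>\<sigma>\<close>, and the field \<open>b = g - \<sigma> ho\<close> of symmetric bilinear forms on the tangent
  bundle vanishes on \<open>W \<times> W\<close>. A symmetric bilinear form that vanishes on the hyperplane
  \<open>ker \<alpha>\<close> is divisible by \<open>\<alpha>\<close> (\<open>sym_bilinear_vanishing_on_hyperplane\<close>): if \<open>\<alpha> q = 1\<close>, then
  \<open>b = 2 \<alpha> \<or> \<beta>\<close> with \<open>\<beta> = b(q, \<cdot>) - b(q, q) \<alpha> / 2\<close>. For \<open>\<alpha> = q\<^sup>*\<close> and \<open>q = qo\<close>, which
  lies in the kernel of \<open>ho\<close>, this gives \<open>\<omega> = g(qo, \<cdot>) - g(qo, qo) q\<^sup>* / 2\<close>. The formula is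
  global and contains only smooth data, so \<open>U\<close> can be the whole manifold.

  Finally, \<open>po\<close> lies in the kernels of both \<open>ho\<close> and \<open>q\<^sup>*\<close>, so the normal form gives
  \<open>g(po, \<cdot>) = \<omega>(po) q\<^sup>*\<close>. If \<open>\<omega>(po)\<close> were 0 at some point, \<open>po\<close> would there be orthogonal to
  the whole tangent space, contrary to the nondegeneracy of \<open>g\<close>
  (\<open>lorentzian_metric_nondegenerate\<close>).\<close>


section \<open>Smooth functions\<close>

text \<open>On an open set, a function may be replaced by any other with the same values there; the
  rules for derivatives of sums and products below hold only at the points of \<open>S\<close> and enter
  the inductions through this lemma.\<close>

lemma C_k_cong:
  assumes "open S" and "\<And>x. x \<in> S \<Longrightarrow> f x = g x" and "C_k k S f"
  shows "C_k k S g"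
  using assms(2,3)
proof (induction k arbitrary: f g)
  case 0
  then show ?case by (simp cong: continuous_on_cong)
next
  case (Suc k)
  have der: "(g has_derivative frechet_derivative f (at x)) (at x)" if "x \<in> S" for x
  proof -
    have "(f has_derivative frechet_derivative f (at x)) (at x)"
      using Suc.prems(2) that by (simp add: frechet_derivative_works)
    then show ?thesis
      using has_derivative_transform_within_open[OF _ \<open>open S\<close> that] Suc.prems(1) by blast
  qed
  have "C_k k S (\<lambda>x. frechet_derivative g (at x) v)" for v
  proof (rule Suc.IH)
    show "C_k k S (\<lambda>x. frechet_derivative f (at x) v)"
      using Suc.prems(2) by simp
    show "frechet_derivative f (at x) v = frechet_derivative g (at x) v" if "x \<in> S" for x
      using frechet_derivative_at[OF der[OF that]] by simp
  qed
  then show ?case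
    using der by (auto simp: differentiable_def)
qed

lemma C_k_Suc_imp_C_k: "C_k (Suc k) S f \<Longrightarrow> C_k k S f"
proof (induction k arbitrary: f)
  case 0
  then show ?case
    by (auto intro!: continuous_at_imp_continuous_on differentiable_imp_continuous_within)
next
  case (Suc k)
  from Suc.prems have "\<forall>x\<in>S. f differentiable (at x)"
    and *: "C_k (Suc k) S (\<lambda>x. frechet_derivative f (at x) v)" for v
    using C_k.simps(2)[of "Suc k" S f] by blast+
  then show ?case
    using Suc.IH[OF *] by simp
qed

lemma C_k_const: "C_k k S (\<lambda>x. c)"
  by (induction k arbitrary: c) (simp_all add: frechet_derivative_const)

lemma C_k_add:
  assumes "open S" and "C_k k S f" and "C_k k S g"
  shows "C_k k S (\<lambda>x. f x + g x)"
  using assms(2,3)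
proof (induction k arbitrary: f g)
  case 0
  then show ?case by (simp add: continuous_on_add)
next
  case (Suc k)
  have "C_k k S (\<lambda>x. frechet_derivative (\<lambda>x. f x + g x) (at x) v)" for v
  proof (rule C_k_cong[OF \<open>open S\<close>])
    show "C_k k S (\<lambda>x. frechet_derivative f (at x) v + frechet_derivative g (at x) v)"
      using Suc by simp
    show "frechet_derivative f (at x) v + frechet_derivative g (at x) v =
        frechet_derivative (\<lambda>x. f x + g x) (at x) v" if "x \<in> S" for x
    proof -
      have "(f has_derivative frechet_derivative f (at x)) (at x)"
        and "(g has_derivative frechet_derivative g (at x)) (at x)"
        using Suc.prems that by (simp_all add: frechet_derivative_works)
      from frechet_derivative_at[OF has_derivative_add[OF this]] show ?thesis
        by (rule fun_cong)
    qed
  qed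
  then show ?case
    using Suc.prems by simp
qed

text \<open>By the product rule, a directional derivative of \<open>f * g\<close> contains both derivatives and
  the functions themselves, and the latter have to be known to be \<open>C_k k\<close> as well.\<close>

lemma C_k_mult:
  fixes f g :: "'b::real_normed_vector \<Rightarrow> 'c::real_normed_algebra"
  assumes "open S" and "C_k k S f" and "C_k k S g"
  shows "C_k k S (\<lambda>x. f x * g x)"
  using assms(2,3)
proof (induction k arbitrary: f g)
  case 0
  then show ?case by (simp add: continuous_on_mult)
next
  case (Suc k)
  have "C_k k S (\<lambda>x. frechet_derivative (\<lambda>x. f x * g x) (at x) v)" for v
  proof (rule C_k_cong[OF \<open>open S\<close>])
    have "C_k k S f" "C_k k S g"
      using Suc.prems by (blast intro: C_k_Suc_imp_C_k)+
    moreover have "C_k k S (\<lambda>x. frechet_derivative f (at x) v)"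
      "C_k k S (\<lambda>x. frechet_derivative g (at x) v)"
      using Suc.prems by simp_all
    ultimately show "C_k k S
        (\<lambda>x. f x * frechet_derivative g (at x) v + frechet_derivative f (at x) v * g x)"
      by (intro C_k_add[OF \<open>open S\<close>] Suc.IH)
    show "f x * frechet_derivative g (at x) v + frechet_derivative f (at x) v * g x =
        frechet_derivative (\<lambda>x. f x * g x) (at x) v" if "x \<in> S" for x
    proof -
      have "(f has_derivative frechet_derivative f (at x)) (at x)"
        and "(g has_derivative frechet_derivative g (at x)) (at x)"
        using Suc.prems that by (simp_all add: frechet_derivative_works)
      from frechet_derivative_at[OF has_derivative_mult[OF this]] show ?thesis
        by (rule fun_cong)
    qed
  qed
  then show ?case
    using Suc.prems by simp
qed

text \<open>The closure properties of \<open>C_k\<close> transfer to functions on the manifold because the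
  coordinate image of an open set is open.\<close>

lemma open_chart_image:
  assumes "smooth_manifold A" and "(U, \<phi>) \<in> A" and "open V"
  shows "open (\<phi> ` (U \<inter> V))"
proof -
  have "is_chart (U, \<phi>)"
    using assms unfolding smooth_manifold_def by blast
  then have U: "open U" "open (\<phi> ` U)" "homeomorphism U (\<phi> ` U) \<phi> (inv_into U \<phi>)"
    by (auto simp: is_chart_def)
  have "openin (top_of_set (\<phi> ` U)) (\<phi> ` (U \<inter> V))"
    using homeomorphism_imp_open_map[OF U(3)] \<open>open V\<close> by (simp add: openin_open_Int)
  then show ?thesis
    using U(2) openin_open_eq by blast
qed

lemma smooth_fun_const: "smooth_fun A S (\<lambda>x. c)"
  by (auto simp: smooth_fun_def C_infinity_def comp_def C_k_const)

lemma smooth_fun_add: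
  assumes "smooth_manifold A" and "open S" and "smooth_fun A S f" and "smooth_fun A S g"
  shows "smooth_fun A S (\<lambda>x. f x + g x)"
  using assms(3,4) open_chart_image[OF assms(1) _ assms(2)]
  unfolding smooth_fun_def C_infinity_def comp_def by (auto intro!: C_k_add)

lemma smooth_fun_mult:
  assumes "smooth_manifold A" and "open S" and "smooth_fun A S f" and "smooth_fun A S g"
  shows "smooth_fun A S (\<lambda>x. f x * g x)"
  using assms(3,4) open_chart_image[OF assms(1) _ assms(2)]
  unfolding smooth_fun_def C_infinity_def comp_def by (auto intro!: C_k_mult)


section \<open>Bilinear forms on tangent spaces\<close>

lemma subspace_tangent_space: "tvec.subspace (tangent_space A x)"
  by (rule tvec.subspaceI)
    (auto simp: tangent_space_def tscale_def algebra_simps plus_fun_def zero_fun_def)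

lemma
  assumes h: "sym_form A D h" and X: "X \<in> D x" and Y: "Y \<in> D x"
  shows sym_form_commute: "h x X Y = h x Y X"
    and sym_form_scale: "h x (tscale c X) Y = c * h x X Y"
    and sym_form_add: "Z \<in> D x \<Longrightarrow> h x (X + Y) Z = h x X Z + h x Y Z"
proof -
  from h have *: "\<forall>X\<in>D x. \<forall>Y\<in>D x. h x X Y = h x Y X"
    unfolding sym_form_def by (elim conjE) (rule spec)
  show "h x X Y = h x Y X"
    using *[rule_format, OF X Y] .
  from h have *: "\<forall>X\<in>D x. \<forall>Y\<in>D x. \<forall>Z\<in>D x. \<forall>c.
      h x (X + Y) Z = h x X Z + h x Y Z \<and> h x (tscale c X) Z = c * h x X Z"
    unfolding sym_form_def by (elim conjE) (rule spec)
  show "h x (tscale c X) Y = c * h x X Y"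
    using *[rule_format, OF X Y Y] by (rule conjunct2)
  show "h x (X + Y) Z = h x X Z + h x Y Z" if "Z \<in> D x"
    using *[rule_format, OF X Y that] by (rule conjunct1)
qed

lemma smooth_sym_form:
  assumes "sym_form A D h" and "open U" and "section_of A U D X" and "section_of A U D Y"
  shows "smooth_fun A U (\<lambda>x. h x (X x) (Y x))"
  using assms unfolding sym_form_def by simp

lemma smooth_one_form:
  assumes "one_form A U \<omega>" and "open V" and "V \<subseteq> U" and "vector_field A V X"
  shows "smooth_fun A V (\<lambda>x. \<omega> x (X x))"
  using assms by (simp add: one_form_def)

text \<open>Split both arguments along \<open>q\<close> and the hyperplane \<open>ker \<alpha>\<close>. The part of \<open>b X Y\<close> in which
  both arguments lie in the hyperplane is 0. The remaining terms are those of
  \<open>\<alpha> X * b q Y + b q X * \<alpha> Y\<close>, except that this sum contains \<open>\<alpha> X * \<alpha> Y * b q q\<close> twice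
  instead of once; hence each factor \<open>b q\<close> is corrected by one half of \<open>b q q * \<alpha>\<close>.\<close>

lemma sym_bilinear_vanishing_on_hyperplane:
  fixes b :: "'a tvec \<Rightarrow> 'a tvec \<Rightarrow> real" and \<alpha> :: "'a tvec \<Rightarrow> real"
  assumes V: "tvec.subspace V"
    and sym: "\<And>X Y. X \<in> V \<Longrightarrow> Y \<in> V \<Longrightarrow> b X Y = b Y X"
    and add: "\<And>X Y Z. X \<in> V \<Longrightarrow> Y \<in> V \<Longrightarrow> Z \<in> V \<Longrightarrow> b (X + Y) Z = b X Z + b Y Z"
    and scale: "\<And>X Z c. X \<in> V \<Longrightarrow> Z \<in> V \<Longrightarrow> b (tscale c X) Z = c * b X Z"
    and \<alpha>_add: "\<And>X Y. X \<in> V \<Longrightarrow> Y \<in> V \<Longrightarrow> \<alpha> (X + Y) = \<alpha> X + \<alpha> Y"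
    and \<alpha>_scale: "\<And>X c. X \<in> V \<Longrightarrow> \<alpha> (tscale c X) = c * \<alpha> X"
    and q: "q \<in> V" "\<alpha> q = 1"
    and vanish: "\<And>X Y. X \<in> V \<Longrightarrow> Y \<in> V \<Longrightarrow> \<alpha> X = 0 \<Longrightarrow> \<alpha> Y = 0 \<Longrightarrow> b X Y = 0"
    and XY: "X \<in> V" "Y \<in> V"
  shows "b X Y = \<alpha> X * (b q Y - 1/2 * b q q * \<alpha> Y) + (b q X - 1/2 * b q q * \<alpha> X) * \<alpha> Y"
proof -
  define w where "w Z = Z + tscale (- \<alpha> Z) q" for Z
  have wV: "w Z \<in> V" if "Z \<in> V" for Z
    using that V q unfolding w_def by (intro tvec.subspace_add tvec.subspace_scale)
  have \<alpha>w: "\<alpha> (w Z) = 0" if "Z \<in> V" for Z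
    using that V q by (simp add: w_def \<alpha>_add \<alpha>_scale tvec.subspace_scale del: tvec.scale_minus_left)
  have left: "b (w Z) T = b Z T - \<alpha> Z * b q T" if "Z \<in> V" "T \<in> V" for Z T
    using that V q by (simp add: w_def add scale tvec.subspace_scale del: tvec.scale_minus_left)
  have "0 = b (w X) (w Y)"
    using XY by (simp add: vanish wV \<alpha>w)
  also have "\<dots> = b (w Y) X - \<alpha> X * b (w Y) q"
    using XY q wV by (simp add: left sym)
  also have "\<dots> = b X Y - \<alpha> Y * b q X - \<alpha> X * (b q Y - \<alpha> Y * b q q)"
    using XY q by (simp add: left sym)
  finally show ?thesis
    by (simp add: algebra_simps)
qed

text \<open>The coefficient of a vector at a member \<open>e\<close> of an orthonormal basis is, up to sign, its
  product with \<open>e\<close>, so a vector orthogonal to the whole basis is 0.\<close>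

lemma lorentzian_metric_nondegenerate:
  assumes g: "lorentzian_metric A g" and X: "X \<in> tangent_space A x"
    and orth: "\<And>Y. Y \<in> tangent_space A x \<Longrightarrow> g x X Y = 0"
  shows "X = 0"
proof -
  let ?T = "tangent_space A x"
  note T = subspace_tangent_space[of A x]
  obtain B e0 where B: "tvec.span B = ?T" "g x e0 e0 = - 1"
    "\<forall>b\<in>B - {e0}. g x b b = 1" "\<forall>b\<in>B. \<forall>b'\<in>B. b \<noteq> b' \<longrightarrow> g x b b' = 0"
    using g unfolding lorentzian_metric_def by blast
  have BT: "b \<in> ?T" if "b \<in> B" for b
    using that B(1) tvec.span_base by blast
  have "sym_form A (tangent_space A) g"
    using g unfolding lorentzian_metric_def by blast
  note add = sym_form_add[OF this] and scale = sym_form_scale[OF this]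
  obtain t r where t: "finite t" "t \<subseteq> B" and Xt: "X = (\<Sum>a\<in>t. tscale (r a) a)"
    using X B(1) unfolding tvec.span_explicit by blast
  have gsum: "(\<Sum>a\<in>s. tscale (r a) a) \<in> ?T \<and>
      g x (\<Sum>a\<in>s. tscale (r a) a) Z = (\<Sum>a\<in>s. r a * g x a Z)"
    if "finite s" "s \<subseteq> B" "Z \<in> ?T" for s Z
    using that(1,2)
  proof (induction s rule: finite_induct)
    case empty
    have "g x (tscale 0 0) Z = 0"
      using scale[of 0 x Z 0] T that(3) by (simp add: tvec.subspace_0)
    then show ?case
      using T by (simp only: sum.empty tvec.scale_zero_right tvec.subspace_0 simp_thms)
  next
    case (insert a s)
    let ?S = "\<Sum>a\<in>s. tscale (r a) a"
    have S: "?S \<in> ?T" "g x ?S Z = (\<Sum>a\<in>s. r a * g x a Z)" and a: "a \<in> ?T"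
      using insert BT by auto
    then have "tscale (r a) a \<in> ?T"
      using T by (simp add: tvec.subspace_scale)
    with S a T that(3) have "tscale (r a) a + ?S \<in> ?T"
      "g x (tscale (r a) a + ?S) Z = r a * g x a Z + (\<Sum>a\<in>s. r a * g x a Z)"
      by (simp_all only: add scale tvec.subspace_add)
    then show ?case
      by (simp only: sum.insert[OF insert.hyps] simp_thms)
  qed
  have "r e = 0" if "e \<in> t" for e
  proof -
    have "e \<in> B"
      using that t by blast
    have "0 = (\<Sum>a\<in>t. r a * g x a e)"
      using gsum[OF t BT[OF \<open>e \<in> B\<close>]] orth[OF BT[OF \<open>e \<in> B\<close>]] Xt by simp
    also have "\<dots> = (\<Sum>a\<in>{e}. r a * g x a e)"
      using that t B(4) \<open>e \<in> B\<close> by (intro sum.mono_neutral_right) auto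
    finally have "r e * g x e e = 0"
      by simp
    moreover have "g x e e \<noteq> 0"
      using B(2,3) \<open>e \<in> B\<close> by (cases "e = e0") auto
    ultimately show ?thesis
      by simp
  qed
  then show ?thesis
    unfolding Xt by simp
qed


section \<open>The normal form of compatible metrics\<close>

theorem corollary2p8:
  fixes A :: "('a::{t2_space, second_countable_topology}, 'b::euclidean_space) chart set"
    and W Wo' :: "'a \<Rightarrow> 'a tvec set"
    and C :: "'a form2 set"
    and g go ho :: "'a form2"
    and po qo :: "'a \<Rightarrow> 'a tvec"
    and pos qos :: "'a form1"
  assumes "smooth_manifold A"
    and "shearfree_structure A W C"
    and "compatible_pair A W C go po"
    and "ho \<in> C"
    and "nonvanishing_section A (form_kernel W ho) po"
    and "rigging A W (form_kernel W ho) Wo' qo"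
    and "dual_forms A W po Wo' qo pos qos"
    and "semipositive_metric A (tangent_space A) ho"
    and "\<forall>x. form_kernel (tangent_space A) ho x = tvec.span {po x, qo x}"
    and "\<forall>x. \<forall>X\<in>tangent_space A x. \<forall>Y\<in>tangent_space A x.
           go x X Y = ho x X Y + 2 * (qos \<or>\<^sub>s pos) x X Y"
    and "compatible_metric A W C g"
  shows "\<forall>x. \<exists>U \<sigma> \<omega>. open U \<and> x \<in> U \<and>
           smooth_fun A U \<sigma> \<and> (\<forall>y\<in>U. 0 < \<sigma> y) \<and>
           one_form A U \<omega> \<and> (\<forall>y\<in>U. \<omega> y (po y) \<noteq> 0) \<and>
           (\<forall>y\<in>U. \<forall>X\<in>tangent_space A y. \<forall>Y\<in>tangent_space A y.
              g y X Y = \<sigma> y * ho y X Y + 2 * (qos \<or>\<^sub>s \<omega>) y X Y \<and>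
              g y X Y = \<sigma> y * ho y X Y + 2 * (flat go po \<or>\<^sub>s \<omega>) y X Y) \<and>
           (\<forall>y\<in>U. \<forall>X\<in>tangent_space A y. flat go po y X = qos y X)"
proof -
  let ?T = "tangent_space A"
  note T = subspace_tangent_space[of A]
  obtain p where p: "compatible_pair A W C g p"
    using assms(11) unfolding compatible_metric_def by blast
  have g: "lorentzian_metric A g" and Cg: "C = conformal_class A W g"
    using p unfolding compatible_pair_def shearfree_pair_def by blast+
  have g_sym: "sym_form A ?T g"
    using g unfolding lorentzian_metric_def by blast
  have ho_sym: "sym_form A ?T ho"
    using assms(8) unfolding semipositive_metric_def by blast
  have qo_vf: "vector_field A UNIV qo"
    using assms(6) unfolding rigging_def by blast
  then have qo: "qo x \<in> ?T x" for x
    by (simp add: vector_field_def)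
  have qos: "one_form A UNIV qos" and qos_qo: "qos x (qo x) = 1"
    and ker_qos: "W x = {X \<in> ?T x. qos x X = 0}" and pos_po: "pos x (po x) = 1" for x
    using assms(7) by (simp_all add: dual_forms_def)
  have qos_add: "qos x (X + Y) = qos x X + qos x Y"
    and qos_scale: "qos x (tscale c X) = c * qos x X"
    if "X \<in> ?T x" "Y \<in> ?T x" for x X Y c
    using qos that by (simp_all add: one_form_def)
  have po: "po x \<in> form_kernel W ho x" and po_nz: "po x \<noteq> 0" for x
    using assms(5) by (simp_all add: nonvanishing_section_def section_of_def)
  then have "po x \<in> W x" for x
    by (simp add: form_kernel_def)
  then have poT: "po x \<in> ?T x" and qos_po: "qos x (po x) = 0" for x
    by (simp_all add: ker_qos)
  have "po x \<in> form_kernel ?T ho x" "qo x \<in> form_kernel ?T ho x" for x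
    using assms(9) by (simp_all add: tvec.span_base)
  then have ho_po: "ho x (po x) X = 0" and ho_qo: "ho x (qo x) X = 0" if "X \<in> ?T x" for x X
    using that by (simp_all add: form_kernel_def)
  have flat: "flat go po x X = qos x X" if "X \<in> ?T x" for x X
    using that assms(10) poT by (simp add: flat_def sym_prod_def ho_po qos_po pos_po)

  \<comment> \<open>Taking \<open>g\<close> as a representative and \<open>go\<close> as the base point of the class, rather than
    comparing \<open>ho\<close> with \<open>g\<close>, yields the smooth factor \<open>\<sigma>\<close> without taking a reciprocal.\<close>
  have "g \<in> C"
    unfolding Cg conformal_class_def
    by (rule CollectI, rule exI[of _ "\<lambda>x. 1"]) (simp add: smooth_fun_const)
  then have "g \<in> conformal_class A W go"
    using assms(3) unfolding compatible_pair_def by blast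
  then obtain \<sigma> where \<sigma>: "smooth_fun A UNIV \<sigma>" "\<And>x. 0 < \<sigma> x"
    and g_go: "\<And>x X Y. X \<in> W x \<Longrightarrow> Y \<in> W x \<Longrightarrow> g x X Y = \<sigma> x * go x X Y"
    unfolding conformal_class_def by blast
  have g_ho: "g x X Y = \<sigma> x * ho x X Y" if "X \<in> W x" "Y \<in> W x" for x X Y
    using g_go[OF that] assms(10) that by (simp add: ker_qos sym_prod_def)

  define \<omega> :: "'a form1" where
    "\<omega> x X = g x (qo x) X - 1/2 * g x (qo x) (qo x) * qos x X" for x X
  note g_commute = sym_form_commute[OF g_sym] and ho_commute = sym_form_commute[OF ho_sym]
    and g_add = sym_form_add[OF g_sym] and ho_add = sym_form_add[OF ho_sym]
    and g_scale = sym_form_scale[OF g_sym] and ho_scale = sym_form_scale[OF ho_sym]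

  have form: "g x X Y = \<sigma> x * ho x X Y + (qos x X * \<omega> x Y + \<omega> x X * qos x Y)"
    if "X \<in> ?T x" "Y \<in> ?T x" for x X Y
  proof -
    let ?b = "\<lambda>X Y. g x X Y - \<sigma> x * ho x X Y"
    have "?b X Y = qos x X * (?b (qo x) Y - 1/2 * ?b (qo x) (qo x) * qos x Y)
        + (?b (qo x) X - 1/2 * ?b (qo x) (qo x) * qos x X) * qos x Y"
    proof (rule sym_bilinear_vanishing_on_hyperplane[where b = ?b and \<alpha> = "qos x" and q = "qo x",
          OF T[of x]])
      show "?b X Y = 0" if "X \<in> ?T x" "Y \<in> ?T x" "qos x X = 0" "qos x Y = 0" for X Y
        using that g_ho by (simp add: ker_qos)
      show "?b X Y = ?b Y X" if "X \<in> ?T x" "Y \<in> ?T x" for X Y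
        using that by (simp add: g_commute ho_commute)
    qed (use that qo in \<open>simp_all add: g_add g_scale ho_add ho_scale qos_add qos_scale qos_qo
          algebra_simps\<close>)
    then show ?thesis
      using that qo by (simp add: ho_qo \<omega>_def)
  qed

  have \<omega>_form: "one_form A UNIV \<omega>"
    unfolding one_form_def
  proof (intro conjI ballI allI impI)
    fix x X Y c
    assume XY: "X \<in> ?T x" "Y \<in> ?T x"
    then have "X + Y \<in> ?T x" "tscale c X \<in> ?T x"
      using T by (simp_all add: tvec.subspace_add tvec.subspace_scale)
    then have "g x (qo x) (X + Y) = g x (qo x) X + g x (qo x) Y"
      "g x (qo x) (tscale c X) = c * g x (qo x) X"
      using g_add[OF XY qo] g_scale[OF XY(1) qo, of c] XY[THEN g_commute[OF qo]]
      by (simp_all add: g_commute[OF qo, of "X + Y"] g_commute[OF qo, of "tscale c X"])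
    then show "\<omega> x (X + Y) = \<omega> x X + \<omega> x Y" "\<omega> x (tscale c X) = c * \<omega> x X"
      using XY by (simp_all add: \<omega>_def qos_add qos_scale algebra_simps)
  next
    fix V X
    assume V: "open V" and X: "vector_field A V X"
    have "vector_field A V qo"
      using qo_vf by (simp add: vector_field_def)
    with X have sec: "section_of A V ?T X" "section_of A V ?T qo"
      by (simp_all add: section_of_def vector_field_def)
    have "smooth_fun A V (\<lambda>x. g x (qo x) (X x))"
      and "smooth_fun A V (\<lambda>x. g x (qo x) (qo x))"
      by (rule smooth_sym_form[OF g_sym V sec(2) sec(1)])
        (rule smooth_sym_form[OF g_sym V sec(2) sec(2)])
    moreover have "smooth_fun A V (\<lambda>x. qos x (X x))"
      by (rule smooth_one_form[OF qos V subset_UNIV X])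
    ultimately have "smooth_fun A V
        (\<lambda>x. g x (qo x) (X x) + - 1/2 * (g x (qo x) (qo x) * qos x (X x)))"
      by (rule smooth_fun_add[OF assms(1) V _ smooth_fun_mult[OF assms(1) V smooth_fun_const
              smooth_fun_mult[OF assms(1) V]]])
    then show "smooth_fun A V (\<lambda>x. \<omega> x (X x))"
      by (simp add: \<omega>_def)
  qed

  have \<omega>_po: "\<omega> x (po x) \<noteq> 0" for x
  proof
    assume "\<omega> x (po x) = 0"
    then have "g x (po x) Y = 0" if "Y \<in> ?T x" for Y
      using form[OF poT that] that by (simp add: ho_po qos_po)
    with lorentzian_metric_nondegenerate[OF g poT] po_nz show False
      by blast
  qed

  have normal_form: "g x X Y = \<sigma> x * ho x X Y + 2 * (qos \<or>\<^sub>s \<omega>) x X Y"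
    "g x X Y = \<sigma> x * ho x X Y + 2 * (flat go po \<or>\<^sub>s \<omega>) x X Y"
    if "X \<in> ?T x" "Y \<in> ?T x" for x X Y
    using form[OF that] that by (simp_all add: sym_prod_def flat)
  show ?thesis
    by (intro allI exI[of _ UNIV] exI[of _ \<sigma>] exI[of _ \<omega>] conjI ballI)
      (rule open_UNIV UNIV_I \<sigma> \<omega>_form \<omega>_po normal_form flat | assumption)+
qed

end
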